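(* Let $m$ and $k$ be positive integers, let $q=2^m$, and assume $\gcd(k,q+1)=1$. Let $F(x)=x^{k(q-1)}$ be the power mapping over $\mathbb{F}_{q^2}$. If $m$ is even, the boomerang spectrum of $F$ is \[\{\nu_{0}=2^{2m-1}+2^{m-1}-2,\ \nu_{2}=2^{2m-1}-2^{m-1}+1\}.\] If $m$ is odd, the boomerang spectrum of $F$ is \[\{\nu_{0}=2^{2m-1}+2^{m-1}-3,\ \nu_{2}=2^{2m-1}-2^{m-1}-1,\ \nu_{4}=3\}.\]
   Context: For a function $F:\mathbb{F}_{p^n}\to\mathbb{F}_{p^n}$ and $a,b\in\mathbb{F}_{p^n}^*$, let $\beta_F(a,b)$ be the number of pairs $(x,y)\in\mathbb{F}_{p^n}^2$ satisfying both $F(x)-F(y)=b$ and $F(x+a)-F(y+a)=b$. Here $p=2$, $n=2m$, and $F(0)=0$. For a power mapping $F$, the boomerang spectrum is the list of the numbers $\nu_i=|\{b\in\mathbb{F}_{p^n}^*:\beta_F(1,b)=i\}|$; values $i$ not listed have $\nu_i=0$. *)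

theory Defs
  imports "HOL-Computational_Algebra.Computational_Algebra"
begin

(* Only meant for nonzero a and b; F is a map on the finite field given by the type. *)
definition boomerang_count :: "('a::finite_field \<Rightarrow> 'a) \<Rightarrow> 'a \<Rightarrow> 'a \<Rightarrow> nat" where
  "boomerang_count F a b =
     card {(x, y). F x - F y = b \<and> F (x + a) - F (y + a) = b}"

(* For a power mapping F, the shift a = 1 determines the boomerang spectrum. *)
definition boomerang_nu :: "('a::finite_field \<Rightarrow> 'a) \<Rightarrow> nat \<Rightarrow> nat" where
  "boomerang_nu F i = card {b. b \<noteq> 0 \<and> boomerang_count F 1 b = i}"

end

(* Write K for the field, L for its subfield with q elements and U for the group of (q + 1)-th roots
of unity. F maps nonzero elements into U and equals 1 exactly on the nonzero elements of L. If four
elements of U sum to zero, they cancel in pairs, and x outside L is determined by F x and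
F (x + 1), because y = c x and y + 1 = d (x + 1) with c, d in L force c = d = 1. Hence a solution
(x, y) with x, y not in {0, 1} has y = x + 1, and G x = F x + F (x + 1) is exactly two-to-one on
K - L; this gives a set B of (q^2 - q) / 2 values b with two such solutions each.

The solutions (0, 1) and (1, 0) add 2 to the count at b = 1. If exactly one of x, y lies in {0, 1},
two elements of U sum to 1, so they are primitive cube roots of unity; this requires 3 to divide
q + 1, i.e. m to be odd, and adds 4 to the count at each of the two primitive cube roots of unity,
which are not in B. The value 1 lies in B exactly when m is odd. *)

theory Submission
  imports Defs
begin

section \<open>Powers in a general field\<close>

lemma card_power_eq_le:
  fixes c :: "'a::field"
  assumes "n > 0"
  shows "card {x. x ^ n = c} \<le> n"
proof -
  let ?p = "monom 1 n - [:c:]"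
  have "degree ([:c:] :: 'a poly) < degree (monom (1::'a) n)"
    using assms by (simp add: degree_monom_eq)
  then have deg: "degree ?p = n"
    by (simp add: degree_add_eq_left degree_monom_eq flip: add_uminus_conv_diff)
  then have "?p \<noteq> 0" using assms by force
  from card_poly_roots_bound[OF this] show ?thesis
    by (simp add: deg poly_monom)
qed

lemma coprime_power_eq_1:
  fixes x :: "'a::field"
  assumes "coprime k n" "x ^ k = 1" "x ^ n = 1"
  shows "x = 1"
proof (cases "k = 0")
  case True
  then show ?thesis using assms by simp
next
  case False
  from bezout_nat[OF False, of n] obtain a b where "k * a = n * b + gcd k n" by blast
  then have "k * a = n * b + 1" using assms(1) by simp
  then have "x ^ (k * a) = x ^ (n * b) * x" by (simp add: power_add)
  then show ?thesis by (simp add: power_mult assms)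
qed

section \<open>The field with \<open>q ^ 2\<close> elements and its characteristic\<close>

locale niho_power =
  fixes m k q :: nat and F :: "'a::finite_field \<Rightarrow> 'a"
  assumes m_pos: "m > 0" and k_pos: "k > 0" and q_def: "q = 2 ^ m"
    and coprime_k: "coprime k (q + 1)"
    and card_UNIV: "card (UNIV :: 'a set) = q ^ 2"
    and F_def: "F = (\<lambda>x. x ^ (k * (q - 1)))"
begin

lemma q_gt_1: "q > 1"
  using m_pos one_less_power[of "2::nat" m] by (simp add: q_def)

lemma CHAR_eq: "CHAR('a) = 2"
proof -
  have "even (q ^ 2)" using m_pos by (simp add: q_def)
  \<comment> \<open>Raising to the power \<open>q ^ 2\<close> fixes every element, and this exponent
    is even, so -1 equals 1.\<close>
  then have "(1::'a) = (- 1) ^ card (UNIV :: 'a set)"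
    by (simp only: card_UNIV neg_one_even_power)
  then have "(1::'a) = - 1"
    by (simp only: finite_field_power_card_eq_same)
  then have "of_nat 2 = (0::'a)" by (simp add: eq_neg_iff_add_eq_0)
  then have "CHAR('a) dvd 2" by (simp only: of_nat_eq_0_iff_char_dvd)
  then show ?thesis
    using CHAR_prime[where 'a='a] primes_dvd_imp_eq two_is_prime_nat by blast
qed

lemma diff_eq_add [simp]: "x - y = x + (y::'a)"
  using minus_CHAR_2[OF CHAR_eq] .

lemma add_self [simp]: "x + x = (0::'a)"
  using diff_eq_add[of x x] by simp

lemma add_self_left [simp]: "x + (x + y) = (y::'a)"
  by (simp flip: add.assoc)

lemma add_eq_0_iff_eq [simp]: "x + y = 0 \<longleftrightarrow> x = (y::'a)"
  by (metis add_self add_right_cancel)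

lemma power_q_eq: "(x::'a) ^ q = x ^ (q - 1) * x"
  using q_gt_1 by (cases q) simp_all

lemma power_q_add: "(x + y) ^ q = x ^ q + (y::'a) ^ q"
  using freshmans_dream'[where 'a='a, of q m x y] by (simp add: CHAR_eq q_def two_is_prime_nat)

lemma power_q_power_q: "((x::'a) ^ q) ^ q = x"
  using finite_field_power_card_eq_same[of x]
  by (simp add: card_UNIV power2_eq_square power_mult)

section \<open>The subfield \<open>L\<close> and its size\<close>

definition L :: "'a set" where "L = {x. x ^ q = x}"
definition U :: "'a set" where "U = {u. u ^ (q + 1) = 1}"

lemma L_0 [simp]: "0 \<in> L" and L_1 [simp]: "1 \<in> L"
  using q_gt_1 by (auto simp: L_def)

lemma L_add: "x \<in> L \<Longrightarrow> y \<in> L \<Longrightarrow> x + y \<in> L"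
  by (simp add: L_def power_q_add)

lemma L_divide: "x \<in> L \<Longrightarrow> y \<in> L \<Longrightarrow> x / y \<in> L"
  by (simp add: L_def power_divide)

lemma L_add_1_iff [simp]: "x + 1 \<in> L \<longleftrightarrow> x \<in> L"
  using L_add[of x 1] L_add[of "x + 1" 1] by (auto simp: add.assoc)

text \<open>The additive map \<open>x \<mapsto> x ^ q + x\<close> has kernel \<open>L\<close> and takes its values in \<open>L\<close>,
  so \<open>q\<^sup>2 \<le> (card L)\<^sup>2\<close>.\<close>
lemma card_L: "card L = q"
proof (rule antisym)
  have "L \<subseteq> insert 0 {x. x ^ (q - 1) = 1}"
    by (auto simp: L_def power_q_eq)
  then have "card L \<le> card (insert 0 {x :: 'a. x ^ (q - 1) = 1})"
    by (rule card_mono[rotated]) simp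
  also have "\<dots> \<le> Suc (q - 1)"
    using card_power_eq_le[of "q - 1" "1::'a"] q_gt_1 by (auto simp: card_insert_if)
  finally show "card L \<le> q" using q_gt_1 by simp
next
  define T where "T x = x ^ q + x" for x :: 'a
  have T_L: "T x \<in> L" for x
    by (simp add: T_def L_def power_q_add power_q_power_q add.commute)
  have fibre: "card {x. T x = c} \<le> card L" for c
  proof (cases "\<exists>a. T a = c")
    case True
    then obtain a where a: "T a = c" by blast
    show ?thesis
    proof (rule card_inj_on_le[where f = "\<lambda>x. x + a"])
      show "(\<lambda>x. x + a) ` {x. T x = c} \<subseteq> L"
      proof (rule image_subsetI)
        fix x assume "x \<in> {x. T x = c}"
        then have "x ^ q + x = a ^ q + a" using a by (simp add: T_def)
        then have "x ^ q + a ^ q = x + a"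
          by (metis add.commute add.left_commute add_self_left)
        then show "x + a \<in> L" by (simp add: L_def power_q_add)
      qed
    qed (auto simp: inj_on_def)
  qed simp
  have "card (UNIV :: 'a set) = (\<Sum>c\<in>range T. card {x. T x = c})"
    using sum.image_gen[of "UNIV :: 'a set" "\<lambda>_. 1::nat" T] by simp
  also have "\<dots> \<le> (\<Sum>c\<in>range T. card L)"
    by (rule sum_mono) (rule fibre)
  also have "\<dots> \<le> card L * card L"
    using T_L card_mono[of L "range T"] by auto
  finally show "q \<le> card L"
    by (simp add: card_UNIV power2_nat_le_eq_le flip: power2_eq_square)
qed

section \<open>Sums of (q + 1)-th roots of unity\<close>

lemma U_power_q_mult: "u \<in> U \<Longrightarrow> u ^ q * u = 1"
  by (simp add: U_def mult.commute)

lemma U_nonzero: "u \<in> U \<Longrightarrow> u \<noteq> 0"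
  by (auto simp: U_def)

text \<open>On \<open>U\<close> the map \<open>u \<mapsto> u ^ q\<close> is inversion, so \<open>a + b = c + d \<noteq> 0\<close> also gives
  \<open>1 / a + 1 / b = 1 / c + 1 / d\<close>: the pairs have the same sum and the same product.\<close>
lemma U_sum_eq:
  assumes "a \<in> U" "b \<in> U" "c \<in> U" "d \<in> U" and eq: "a + b = c + d" and ne: "a \<noteq> b"
  shows "a = c \<and> b = d \<or> a = d \<and> b = c"
proof -
  have pow: "u ^ q = 1 / u" if "u \<in> U" for u
    using U_power_q_mult[OF that] U_nonzero[OF that] by (simp add: field_simps)
  have nz: "a \<noteq> 0" "b \<noteq> 0" "c \<noteq> 0" "d \<noteq> 0"
    using assms U_nonzero by auto
  have "1 / a + 1 / b = 1 / c + 1 / d"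
    using arg_cong[OF eq, of "\<lambda>x. x ^ q"] assms(1-4) by (simp add: power_q_add pow)
  then have "(a + b) * (c * d) = (c + d) * (a * b)"
    using nz by (simp add: divide_simps) (simp add: algebra_simps)
  then have prod: "a * b = c * d"
    using eq ne by (metis add_eq_0_iff_eq mult_left_cancel)
  \<comment> \<open>This evaluates at \<open>a\<close> the quadratic with roots \<open>c\<close> and
    \<open>d\<close>; equal sums and products make it the quadratic with roots \<open>a\<close> and
    \<open>b\<close>.\<close>
  have "(a + c) * (a + d) = a * a + a * (c + d) + c * d"
    by (simp add: algebra_simps)
  also have "\<dots> = 0"
    by (simp add: eq[symmetric] prod[symmetric] algebra_simps)
  finally have "a = c \<or> a = d" by simp
  then show ?thesis using eq by (auto simp: add.commute)
qed

text \<open>Since \<open>v = u + 1\<close>, the elements \<open>u\<close> and \<open>u + 1\<close>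
  both have norm 1 over \<open>L\<close>. Expanding the second norm shows that \<open>u\<close> has
  trace 1, so \<open>u ^ q = u + 1\<close>, and the first norm becomes
  \<open>(u + 1) * u = 1\<close>. Hence \<open>u\<close> is a primitive cube root of unity.\<close>

lemma U_sum_eq_1:
  assumes "u \<in> U" "v \<in> U" "u + v = 1"
  shows "u ^ 2 = u + 1" "u \<noteq> 1"
proof -
  have v: "v = u + 1" using assms(3) by (metis add_self_left)
  have "u ^ q * u = 1" "(u ^ q + 1) * (u + 1) = 1"
    using U_power_q_mult[OF assms(1)] U_power_q_mult[OF assms(2)] by (simp_all add: v power_q_add)
  then have h: "u ^ q + u = 1"
    by (simp add: algebra_simps)
  then have "u ^ q = u + 1" by (metis add.commute add_self_left)
  then show "u ^ 2 = u + 1"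
    using \<open>u ^ q * u = 1\<close> by (simp add: power2_eq_square algebra_simps) (metis add.commute add_self_left)
  show "u \<noteq> 1" using v U_nonzero[OF assms(2)] by auto
qed

lemma cube_root: "u ^ 2 = u + 1 \<Longrightarrow> u ^ 3 = (1::'a)"
  by (simp add: power3_eq_cube power2_eq_square algebra_simps)

section \<open>The power map \<open>F\<close> and its fibres\<close>

lemma F_0 [simp]: "F 0 = 0"
  using k_pos q_gt_1 by (simp add: F_def)

lemma F_1 [simp]: "F 1 = 1"
  by (simp add: F_def)

lemma power_order:
  assumes "(x::'a) \<noteq> 0" shows "x ^ ((q - 1) * (q + 1)) = 1"
proof -
  have "q ^ 2 = Suc ((q - 1) * (q + 1))"
    using q_gt_1 by (cases q) (auto simp: power2_eq_square)
  then have "x ^ ((q - 1) * (q + 1)) * x = x"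
    using finite_field_power_card_eq_same[of x] by (simp add: card_UNIV mult.commute)
  then show ?thesis using assms by simp
qed

lemma F_U:
  assumes "x \<noteq> 0" shows "F x \<in> U"
proof -
  have "F x ^ (q + 1) = (x ^ ((q - 1) * (q + 1))) ^ k"
    by (simp only: F_def mult_ac flip: power_mult)
  then show ?thesis using power_order[OF assms] by (simp add: U_def)
qed

lemma F_eq_0_iff [simp]: "F x = 0 \<longleftrightarrow> x = 0"
  using F_U[of x] U_nonzero by auto

text \<open>Coprimality of \<open>k\<close> and \<open>q + 1\<close> enters here: for
  \<open>c = y / x\<close>, the order of \<open>c ^ (q - 1)\<close> divides both numbers, so
  \<open>c ^ (q - 1) = 1\<close>.\<close>

lemma F_eqE:
  assumes "F x = F y" "x \<noteq> 0"
  obtains c where "c \<in> L" "y = c * x"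
proof -
  have "y \<noteq> 0" using assms F_eq_0_iff by metis
  define c where "c = y / x"
  have y: "y = c * x" and c0: "c \<noteq> 0"
    using assms \<open>y \<noteq> 0\<close> by (auto simp: c_def)
  have "F c = 1"
    using assms F_eq_0_iff[of x] by (simp add: c_def F_def power_divide)
  then have "(c ^ (q - 1)) ^ k = 1"
    by (simp add: F_def mult.commute flip: power_mult)
  moreover have "(c ^ (q - 1)) ^ (q + 1) = 1"
    using power_order[OF c0] by (simp only: power_mult)
  ultimately have "c ^ (q - 1) = 1"
    using coprime_power_eq_1 coprime_k by blast
  then have "c \<in> L" by (simp add: L_def power_q_eq)
  with y show thesis by (rule that[rotated])
qed

lemma F_L: "x \<in> L \<Longrightarrow> x \<noteq> 0 \<Longrightarrow> F x = 1"
proof -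
  assume "x \<in> L" "x \<noteq> 0"
  then have "x ^ (q - 1) = 1" by (simp add: L_def power_q_eq)
  then show ?thesis unfolding F_def by (simp add: mult.commute[of k] power_mult)
qed

lemma F_eq_1_iff: "F x = 1 \<longleftrightarrow> x \<in> L \<and> x \<noteq> 0"
proof
  assume "F x = 1"
  then have "F 1 = F x" by simp
  then obtain c where "c \<in> L" "x = c * 1" by (rule F_eqE) auto
  then show "x \<in> L \<and> x \<noteq> 0" using \<open>F x = 1\<close> by auto
qed (auto simp: F_L)

text \<open>For \<open>x\<close> outside \<open>L\<close>, the elements 1 and \<open>x\<close> are
  linearly independent over \<open>L\<close>, so the equation \<open>c * x + 1 = d * x + d\<close>
  can be compared coefficientwise.\<close>

lemma F_inj:
  assumes "x \<notin> L" "F x = F y" "F (x + 1) = F (y + 1)"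
  shows "x = y"
proof -
  have "x \<noteq> 0" "x + 1 \<noteq> 0" using assms(1) by auto
  then obtain c d where c: "c \<in> L" "y = c * x" and d: "d \<in> L" "y + 1 = d * (x + 1)"
    using F_eqE assms(2,3) by metis
  have "c * x + 1 = d * x + d" using c d by (simp add: algebra_simps)
  then have eq: "(c + d) * x = d + 1"
    by (metis add.commute add.left_commute add_self_left distrib_right)
  have "c = d"
  proof (rule ccontr)
    assume "c \<noteq> d"
    then have "x = (d + 1) / (c + d)" using eq by (metis add_eq_0_iff_eq nonzero_mult_div_cancel_left)
    then have "x \<in> L" using c d L_divide L_add L_1 by metis
    with assms show False by simp
  qed
  with eq have "d = 1" by simp
  with \<open>c = d\<close> c show ?thesis by simp
qed

section \<open>The map \<open>G\<close> and its image \<open>B\<close> of the complement of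
  \<open>L\<close>\<close>

definition G :: "'a \<Rightarrow> 'a" where "G x = F x + F (x + 1)"

lemma G_add_1 [simp]: "G (x + 1) = G x"
  by (simp add: G_def add.assoc add.commute)

lemma F_add_1_ne:
  assumes "x \<notin> L" shows "F x \<noteq> F (x + 1)"
  using F_inj[of x "x + 1"] assms by (auto simp: add.assoc)

lemma G_nonzero: "x \<notin> L \<Longrightarrow> G x \<noteq> 0"
  using F_add_1_ne by (simp add: G_def)

lemma G_L: "x \<in> L \<Longrightarrow> G x = (if x = 0 \<or> x = 1 then 1 else 0)"
  by (auto simp: G_def F_L)

text \<open>By \<open>U_sum_eq\<close> the four values of \<open>F\<close> match in pairs. One
  matching gives \<open>y = x\<close> by \<open>F_inj\<close>, the other gives
  \<open>y = x + 1\<close>.\<close>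

lemma G_eq_iff:
  assumes "x \<notin> L" "y \<notin> L"
  shows "G x = G y \<longleftrightarrow> y = x \<or> y = x + 1"
proof
  assume eq: "G x = G y"
  have "x \<noteq> 0" "y \<noteq> 0" "x + 1 \<noteq> 0" "y + 1 \<noteq> 0" using assms by auto
  then have "F x = F y \<and> F (x + 1) = F (y + 1) \<or> F x = F (y + 1) \<and> F (x + 1) = F y"
    using U_sum_eq[OF F_U F_U F_U F_U] F_add_1_ne[OF assms(1)] eq unfolding G_def by blast
  then have "x = y \<or> x = y + 1"
    using F_inj[OF assms(1), of y] F_inj[OF assms(1), of "y + 1"] by (auto simp: add.assoc)
  then show "y = x \<or> y = x + 1" by (auto simp: add.assoc)
qed auto

definition B :: "'a set" where "B = G ` (- L)"

lemma card_fibre_B: "b \<in> B \<Longrightarrow> card {x \<in> - L. G x = b} = 2"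
proof -
  assume "b \<in> B"
  then obtain x where "x \<notin> L" "b = G x" by (auto simp: B_def)
  then have "{x \<in> - L. G x = b} = {x, x + 1}"
    using G_eq_iff[of x] by (auto simp: eq_commute[of _ "G x"])
  then show ?thesis by (simp add: card_insert_if)
qed

text \<open>The complement of \<open>L\<close> has \<open>q ^ 2 - q\<close> elements and splits into
  fibres of \<open>G\<close> of size 2.\<close>

lemma card_B: "2 * card B + q = q ^ 2"
proof -
  have "card (- L) = (\<Sum>b\<in>B. card {x \<in> - L. G x = b})"
    using sum.image_gen[of "- L" "\<lambda>_. 1::nat" G] by (simp add: B_def)
  also have "\<dots> = 2 * card B" using card_fibre_B by simp
  finally have "card (- L) = 2 * card B" .
  moreover have "card (- L) + card L = q ^ 2"
    using card_UNIV card_Un_disjoint[of "- L" L] by simp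
  ultimately show ?thesis using card_L by simp
qed

lemma zero_notin_B: "0 \<notin> B"
  using G_nonzero by (auto simp: B_def)

text \<open>The second summand comes from the points 0 and 1, the only points of \<open>L\<close>
  where \<open>G\<close> does not vanish.\<close>

lemma card_G_eq:
  assumes "b \<noteq> 0"
  shows "card {x. G x = b} = (if b \<in> B then 2 else 0) + (if b = 1 then 2 else 0)"
proof -
  have "{x. G x = b} = {x \<in> - L. G x = b} \<union> (if b = 1 then {0, 1} else {})"
    using assms by (auto simp: G_L split: if_splits)
  moreover have "{x \<in> - L. G x = b} \<inter> (if b = 1 then {0, 1} else {}) = {}"
    by (auto split: if_splits)
  moreover have "card {x \<in> - L. G x = b} = (if b \<in> B then 2 else 0)"
    using card_fibre_B by (auto simp: B_def)
  ultimately show ?thesis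
    by (simp add: card_Un_disjoint)
qed

section \<open>Solutions of the boomerang system with shift 1\<close>

definition sols :: "'a \<Rightarrow> ('a \<times> 'a) set" where
  "sols b = {(x, y). F x + F y = b \<and> F (x + 1) + F (y + 1) = b}"

lemma boomerang_count_eq: "boomerang_count F 1 b = card (sols b)"
  by (simp add: boomerang_count_def sols_def)

text \<open>Together with \<open>sols_add_1\<close>, this symmetry reduces every solution with
  exactly one coordinate in {0, 1} to one whose first coordinate is 0.\<close>

lemma sols_swap: "(x, y) \<in> sols b \<longleftrightarrow> (y, x) \<in> sols b"
  by (auto simp: sols_def add.commute)

lemma sols_add_1: "(x + 1, y + 1) \<in> sols b \<longleftrightarrow> (x, y) \<in> sols b"
  by (auto simp: sols_def add.assoc)

text \<open>All four values of \<open>F\<close> lie in \<open>U\<close>, so \<open>U_sum_eq\<close>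
  applies. As \<open>b\<close> is nonzero, \<open>x\<close> and \<open>y\<close> are not both in
  \<open>L\<close>; this excludes the matching \<open>F x = F (x + 1)\<close>,
  \<open>F y = F (y + 1)\<close>, and the remaining one yields \<open>x = y + 1\<close> by
  \<open>F_inj\<close>.\<close>

lemma sols_generic:
  assumes "(x, y) \<in> sols b" "b \<noteq> 0" "x \<notin> {0, 1}" "y \<notin> {0, 1}"
  shows "y = x + 1"
proof -
  have nz: "x \<noteq> 0" "y \<noteq> 0" "x + 1 \<noteq> 0" "y + 1 \<noteq> 0" using assms(3,4) by auto
  have eq: "F x + F y = F (x + 1) + F (y + 1)" and b: "F x + F y = b"
    using assms(1) by (auto simp: sols_def)
  with \<open>b \<noteq> 0\<close> have ne: "F x \<noteq> F y" by auto
  have L: "x \<notin> L \<or> y \<notin> L" using ne F_L nz by metis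
  have "F x = F (x + 1) \<and> F y = F (y + 1) \<or> F x = F (y + 1) \<and> F y = F (x + 1)"
    using U_sum_eq[OF F_U F_U F_U F_U eq ne] nz by blast
  then have "F x = F (y + 1)" "F y = F (x + 1)"
    using L F_add_1_ne by auto
  then have "x = y + 1 \<or> y = x + 1"
    using L F_inj[of x "y + 1"] F_inj[of y "x + 1"] by (auto simp: add.assoc)
  then show ?thesis by (auto simp: add.assoc)
qed

text \<open>Because \<open>F 0 = 0\<close> and \<open>F 1 = 1\<close>, the system prescribes
  \<open>F y\<close> and \<open>F (y + 1)\<close>, two elements of \<open>U\<close> with sum
  1.\<close>

lemma sols_0:
  assumes "(0, y) \<in> sols b" "y \<notin> {0, 1}"
  shows "F y = b" "F (y + 1) = b + 1" "b \<in> U" "b ^ 2 = b + 1" "y \<notin> L"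
proof -
  show b: "F y = b" using assms(1) by (simp add: sols_def)
  have "1 + F (y + 1) = b" using assms(1) by (simp add: sols_def)
  then show b1: "F (y + 1) = b + 1" by (metis add.commute add_self_left)
  have "y \<noteq> 0" "y + 1 \<noteq> 0" using assms(2) by auto
  then have U: "F y \<in> U" "F (y + 1) \<in> U" using F_U by blast+
  then show "b \<in> U" using b by simp
  have "F y + F (y + 1) = 1" using b b1 by simp
  from U_sum_eq_1[OF U this] show "b ^ 2 = b + 1" "y \<notin> L"
    using b F_L assms(2) by auto
qed

lemma sols_diag: "(x, x + 1) \<in> sols b \<longleftrightarrow> G x = b"
  by (auto simp: sols_def G_def add.commute add.assoc)

lemma sols_cases:
  assumes "(x, y) \<in> sols b" "b \<noteq> 0"
  obtains "y = x + 1"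
  | z where "z \<notin> {0, 1}" "(0, z) \<in> sols b" "(x, y) \<in> {(0, z), (z, 0), (1, z + 1), (z + 1, 1)}"
proof -
  have "x \<noteq> y" using assms by (auto simp: sols_def)
  consider "x \<notin> {0, 1}" "y \<notin> {0, 1}" | "x \<in> {0, 1}" "y \<in> {0, 1}"
    | "x = 0" "y \<notin> {0, 1}" | "x = 1" "y \<notin> {0, 1}"
    | "y = 0" "x \<notin> {0, 1}" | "y = 1" "x \<notin> {0, 1}" by blast
  then show thesis
  proof cases
    case 1
    then show thesis using sols_generic assms that(1) by blast
  next
    case 2
    then show thesis using \<open>x \<noteq> y\<close> that(1) by auto
  next
    case 3
    then show thesis using assms that(2)[of y] by auto
  next
    case 4
    then show thesis using assms that(2)[of "y + 1"] sols_add_1[of x y b] by (auto simp: add.assoc)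
  next
    case 5
    then show thesis using assms that(2)[of x] sols_swap[of x y] by auto
  next
    case 6
    then show thesis using assms that(2)[of "x + 1"] sols_swap[of x y] sols_add_1[of y x b]
      by (auto simp: add.assoc)
  qed
qed

section \<open>Counts without exceptional solutions, and the case of even \<open>m\<close>\<close>

lemma boomerang_count_no_root:
  assumes "b \<noteq> 0" "\<And>y. y \<notin> {0, 1} \<Longrightarrow> (0, y) \<notin> sols b"
  shows "boomerang_count F 1 b = (if b \<in> B then 2 else 0) + (if b = 1 then 2 else 0)"
proof -
  have "y = x + 1 \<and> G x = b" if "(x, y) \<in> sols b" for x y
    using that assms(1)
    by (rule sols_cases) (use assms(2) that in \<open>auto simp flip: sols_diag\<close>)
  then have "sols b = (\<lambda>x. (x, x + 1)) ` {x. G x = b}"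
    using sols_diag by fast
  then have "card (sols b) = card {x. G x = b}"
    by (simp add: card_image inj_on_def)
  then show ?thesis
    using assms(1) by (simp add: boomerang_count_eq card_G_eq)
qed

text \<open>For even \<open>m\<close>, \<open>q\<close> is a power of 4, so 3 does not divide
  \<open>q + 1\<close> and \<open>U\<close> has no element of order 3.\<close>

lemma cube_root_notin_U:
  assumes "even m" "u \<in> U" "u ^ 2 = u + 1"
  shows False
proof -
  from \<open>even m\<close> obtain j where "m = 2 * j" ..
  then have "q mod 3 = 1"
    using power_mod[of "4::nat" 3 j] by (simp add: q_def power_mult)
  then have "\<not> 3 dvd q + 1" by presburger
  then have "coprime 3 (q + 1)"
    by (intro prime_imp_coprime) simp_all
  moreover have "u ^ (q + 1) = 1" using assms by (simp add: U_def)
  ultimately have "u = 1"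
    using coprime_power_eq_1 cube_root[OF assms(3)] by blast
  with assms(3) show False by simp
qed

lemma boomerang_count_even:
  assumes "even m" "b \<noteq> 0"
  shows "boomerang_count F 1 b = (if b \<in> B then 2 else 0) + (if b = 1 then 2 else 0)"
proof (rule boomerang_count_no_root[OF assms(2)])
  show "(0, y) \<notin> sols b" if "y \<notin> {0, 1}" for y
    using sols_0(3,4)[of y b] that cube_root_notin_U[OF assms(1)] by blast
qed

lemma one_notin_B_even:
  assumes "even m"
  shows "1 \<notin> B"
proof
  assume "1 \<in> B"
  then obtain x where x: "x \<notin> L" "F x + F (x + 1) = 1" by (auto simp: B_def G_def)
  then have "x \<noteq> 0" "x + 1 \<noteq> 0" by auto
  then have U: "F x \<in> U" "F (x + 1) \<in> U" using F_U by blast+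
  show False
    using U_sum_eq_1[OF U x(2)] U(1) cube_root_notin_U assms by blast
qed

section \<open>Odd \<open>m\<close>: cube roots of unity and the exceptional solutions\<close>

lemma q_mod_3_odd:
  assumes "odd m"
  shows "q mod 3 = 2"
proof -
  from assms obtain j where "m = 2 * j + 1" by (rule oddE)
  then have "q = 2 * 4 ^ j" by (simp add: q_def power_mult)
  moreover have "4 ^ j mod 3 = (1::nat)" using power_mod[of "4::nat" 3 j] by simp
  ultimately show ?thesis by presburger
qed

lemma cube_root_exists:
  assumes "odd m"
  obtains w :: 'a where "w ^ 2 = w + 1" "w \<notin> L"
proof -
  have q3: "q mod 3 = 2" using q_mod_3_odd[OF assms] .
  define t where "t = q div 3"
  have q: "q = 3 * t + 2" using div_mult_mod_eq[of q 3] q3 unfolding t_def by linarith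
  \<comment> \<open>This is one third of \<open>q ^ 2 - 1\<close>, because
    \<open>q + 1 = 3 * (t + 1)\<close>. Too few elements satisfy \<open>x ^ r = 1\<close> to exhaust
    the nonzero ones, and any other nonzero \<open>x\<close> yields a primitive cube root
    \<open>x ^ r\<close>.\<close>
  define r where "r = (q - 1) * (t + 1)"
  have r3: "(q - 1) * (q + 1) = r * 3" by (simp add: r_def q algebra_simps)
  have "r > 0" using q_gt_1 by (simp add: r_def)
  have "card (insert 0 {x :: 'a. x ^ r = 1}) \<le> Suc r"
    using card_power_eq_le[OF \<open>r > 0\<close>, of "1::'a"] by (auto simp: card_insert_if)
  also have "\<dots> < q ^ 2"
    by (simp add: r_def q power2_eq_square algebra_simps)
  finally have "insert 0 {x :: 'a. x ^ r = 1} \<noteq> UNIV"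
    using card_UNIV by force
  then obtain x :: 'a where x: "x \<noteq> 0" "x ^ r \<noteq> 1" by auto
  define w where "w = x ^ r"
  have w3: "w ^ 3 = 1"
    using power_order[OF x(1)] unfolding r3 by (simp add: w_def power_mult)
  have "(w + 1) * (w ^ 2 + w + 1) = w ^ 3 + 1"
    by (simp add: power2_eq_square power3_eq_cube algebra_simps)
  then have "w ^ 2 + w + 1 = 0"
    using x(2) w3 by (simp add: w_def)
  then have w2: "w ^ 2 = w + 1" by (simp add: add.assoc)
  \<comment> \<open>As \<open>q\<close> is 2 modulo 3, the Frobenius map of \<open>L\<close>
    exchanges the two primitive cube roots, so neither lies in \<open>L\<close>.\<close>
  have "w ^ q = (w ^ 3) ^ t * w ^ 2"
    unfolding q by (simp only: power_add power_mult)
  then have "w ^ q = w + 1" by (simp add: w3 w2)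
  then have "w \<notin> L" by (auto simp: L_def)
  with w2 show thesis by (rule that)
qed

context
  fixes w :: 'a
  assumes w2: "w ^ 2 = w + 1" and w_notin_L: "w \<notin> L"
begin

text \<open>\<open>F\<close> commutes with powers, so \<open>F w\<close> is again a cube root of
  unity, different from 1 because \<open>w\<close> is not in \<open>L\<close>; moreover
  \<open>w + 1\<close> is \<open>w ^ 2\<close>.\<close>

lemma F_w: "F w ^ 2 = F w + 1" and F_w_1: "F (w + 1) = F w + 1"
proof -
  have pow: "F (w ^ n) = F w ^ n" for n
    by (simp add: F_def mult.commute flip: power_mult)
  have "F w ^ 3 = 1" using pow[of 3] cube_root[OF w2] by simp
  moreover have "(F w + 1) * (F w ^ 2 + F w + 1) = F w ^ 3 + 1"
    by (simp add: power2_eq_square power3_eq_cube algebra_simps)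
  moreover have "F w \<noteq> 1" using w_notin_L by (simp add: F_eq_1_iff)
  ultimately have "F w ^ 2 + F w + 1 = 0" by simp
  then show eq: "F w ^ 2 = F w + 1" by (simp add: add.assoc)
  show "F (w + 1) = F w + 1" using pow[of 2] by (simp add: w2 eq)
qed

text \<open>If \<open>F w\<close> were \<open>G x\<close> with \<open>x\<close> outside
  \<open>L\<close>, then \<open>F x + F (x + 1) = 1 + F (w + 1)\<close> would be a relation in
  \<open>U\<close>. One of \<open>F x\<close> and \<open>F (x + 1)\<close> would be 1, putting
  \<open>x\<close> into \<open>L\<close>.\<close>

lemma F_w_notin: "F w \<notin> B \<union> {0, 1}"
proof -
  have "w \<noteq> 0" "w + 1 \<noteq> 0" using w_notin_L by auto
  moreover have "F w \<notin> B"
  proof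
    assume "F w \<in> B"
    then obtain x where x: "x \<notin> L" and "F w = F x + F (x + 1)" by (auto simp: B_def G_def)
    then have "F x + F (x + 1) = 1 + F (w + 1)"
      by (metis F_w_1 add.commute add_self_left)
    moreover have "x \<noteq> 0" "x + 1 \<noteq> 0" "1 \<in> U" using x by (auto simp: U_def)
    ultimately have "F x = 1 \<or> F (x + 1) = 1"
      using U_sum_eq[OF F_U F_U _ F_U] F_add_1_ne[OF x] \<open>w + 1 \<noteq> 0\<close> by metis
    then show False using x by (simp add: F_eq_1_iff)
  qed
  moreover have "F w \<noteq> 1" using w_notin_L by (simp add: F_eq_1_iff)
  ultimately show ?thesis by simp
qed

lemma one_in_B: "1 \<in> B"
proof -
  have "G w = 1" by (simp add: G_def F_w_1)
  then show ?thesis using w_notin_L by (force simp: B_def)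
qed

text \<open>By \<open>sols_0\<close>, \<open>b\<close> is a root of X^2 + X + 1, whose roots are
  \<open>F w\<close> and \<open>F w + 1\<close>; then \<open>F_inj\<close> recovers \<open>y\<close>
  from \<open>F y\<close> and \<open>F (y + 1)\<close>.\<close>

lemma sols_0_iff:
  assumes "y \<notin> {0, 1}"
  shows "(0, y) \<in> sols b \<longleftrightarrow> b = F w \<and> y = w \<or> b = F w + 1 \<and> y = w + 1"
proof
  assume *: "(0, y) \<in> sols b"
  note y = sols_0[OF * assms]
  have "(b + F w) * (b + F w + 1) = (b ^ 2 + b) + (F w ^ 2 + F w)"
    by (simp add: power2_eq_square algebra_simps)
  also have "\<dots> = 0" by (simp add: y(4) F_w add.assoc add.left_commute)
  finally have "b = F w \<or> b = F w + 1" by (auto simp: add.assoc)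
  then show "b = F w \<and> y = w \<or> b = F w + 1 \<and> y = w + 1"
  proof
    assume b: "b = F w"
    then have "y = w" using F_inj[of y w] y by (simp add: F_w_1)
    with b show ?thesis by simp
  next
    assume b: "b = F w + 1"
    then have "y = w + 1" using F_inj[of y "w + 1"] y by (simp add: F_w_1 add.assoc)
    with b show ?thesis by simp
  qed
next
  have "1 + (F w + 1) = F w" by (metis add.commute add_self_left)
  moreover assume "b = F w \<and> y = w \<or> b = F w + 1 \<and> y = w + 1"
  ultimately show "(0, y) \<in> sols b"
    by (auto simp: sols_def F_w_1 add.assoc add.commute[of 1 "F w"])
qed

text \<open>No solution has the form \<open>(x, x + 1)\<close>, since \<open>F w\<close> is not a
  value of \<open>G\<close>. What remains is the orbit of \<open>(0, w)\<close> under the swap and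
  the common shift by 1.\<close>

lemma boomerang_count_F_w: "boomerang_count F 1 (F w) = 4"
proof -
  have nz: "F w \<noteq> 0" "w \<notin> {0, 1}" using F_w_notin w_notin_L by auto
  have "x \<notin> L \<Longrightarrow> G x \<in> B" for x by (simp add: B_def)
  then have no_diag: "G x \<noteq> F w" for x
    using F_w_notin G_L[of x] by (metis UnCI insertCI)
  have "(0, w) \<in> sols (F w)" using sols_0_iff nz by blast
  then have "{(0, w), (w, 0), (1, w + 1), (w + 1, 1)} \<subseteq> sols (F w)"
    using sols_add_1[of 0 w] sols_add_1[of w 0] sols_swap[of 0 w] by auto
  moreover have "sols (F w) \<subseteq> {(0, w), (w, 0), (1, w + 1), (w + 1, 1)}"
  proof (rule subrelI)
    fix x y assume "(x, y) \<in> sols (F w)"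
    then show "(x, y) \<in> {(0, w), (w, 0), (1, w + 1), (w + 1, 1)}"
      using nz(1)
    proof (cases rule: sols_cases)
      case 1
      then show ?thesis using \<open>(x, y) \<in> sols (F w)\<close> no_diag by (simp add: sols_diag)
    next
      case (2 z)
      then have "z = w" using sols_0_iff[of z "F w"] by auto
      with 2 show ?thesis by simp
    qed
  qed
  ultimately have "sols (F w) = {(0, w), (w, 0), (1, w + 1), (w + 1, 1)}" by blast
  then show ?thesis
    using nz by (auto simp: boomerang_count_eq card_insert_if)
qed

end

section \<open>Assembling the spectrum\<close>

lemma card_B_int: "int (card B) = 2 ^ (2 * m - 1) - 2 ^ (m - 1)"
proof -
  have "2 * (2::int) ^ (2 * m - 1) = 2 ^ (2 * m)" "2 * (2::int) ^ (m - 1) = 2 ^ m"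
    using m_pos by (simp_all flip: power_Suc)
  moreover have "2 * int (card B) + 2 ^ m = 2 ^ (2 * m)"
    using arg_cong[OF card_B, of int] by (simp add: q_def power_mult mult.commute)
  ultimately show ?thesis by linarith
qed

text \<open>Writing \<open>q ^ 2\<close> as \<open>2 * 2 ^ (2 * m - 1)\<close> keeps the final
  counts linear in the powers that occur in the spectrum.\<close>

lemma card_nonzero_Diff:
  assumes "0 \<notin> A"
  shows "int (card (UNIV - insert 0 A :: 'a set)) = 2 * 2 ^ (2 * m - 1) - 1 - int (card A)"
proof -
  have "int (card (UNIV - insert 0 A :: 'a set)) = int (q ^ 2) - int (card (insert 0 A))"
    using card_mono[of "UNIV :: 'a set" "insert 0 A"]
    by (subst card_Diff_subset) (auto simp: card_UNIV of_nat_diff)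
  also have "int (q ^ 2) = 2 * 2 ^ (2 * m - 1)"
    using m_pos by (simp add: q_def mult.commute flip: power_Suc power_mult)
  finally show ?thesis using assms by simp
qed

lemma spectrum_even:
  assumes "even m"
  shows "int (boomerang_nu F 0) = 2 ^ (2 * m - 1) + 2 ^ (m - 1) - 2"
    and "int (boomerang_nu F 2) = 2 ^ (2 * m - 1) - 2 ^ (m - 1) + 1"
    and "i \<notin> {0, 2} \<Longrightarrow> boomerang_nu F i = 0"
proof -
  \<comment> \<open>For even \<open>m\<close>, 1 is not in \<open>B\<close>, but the solutions (0,
    1) and (1, 0) give it the same count 2 as the elements of \<open>B\<close>.\<close>
  let ?A = "insert 1 B"
  have count: "boomerang_count F 1 b = (if b \<in> ?A then 2 else 0)" if "b \<noteq> 0" for b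
    using boomerang_count_even[OF assms that] one_notin_B_even[OF assms] by auto
  have A: "int (card ?A) = 2 ^ (2 * m - 1) - 2 ^ (m - 1) + 1"
    using one_notin_B_even[OF assms] card_B_int by simp
  have nu: "boomerang_nu F i = card {b. b \<noteq> 0 \<and> (if b \<in> ?A then 2 else 0) = i}" for i
    unfolding boomerang_nu_def by (metis (no_types, lifting) count)
  have "{b. b \<noteq> 0 \<and> (if b \<in> ?A then 2 else 0) = (0::nat)} = UNIV - insert 0 ?A"
    by auto
  then show "int (boomerang_nu F 0) = 2 ^ (2 * m - 1) + 2 ^ (m - 1) - 2"
    unfolding nu using card_nonzero_Diff[of ?A] A zero_notin_B by simp
  have "{b. b \<noteq> 0 \<and> (if b \<in> ?A then 2 else 0) = (2::nat)} = ?A"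
    using zero_notin_B by auto
  then show "int (boomerang_nu F 2) = 2 ^ (2 * m - 1) - 2 ^ (m - 1) + 1"
    unfolding nu using A by simp
  show "i \<notin> {0, 2} \<Longrightarrow> boomerang_nu F i = 0"
    unfolding nu by (auto simp: card_eq_0_iff)
qed

lemma spectrum_odd:
  assumes "odd m"
  shows "int (boomerang_nu F 0) = 2 ^ (2 * m - 1) + 2 ^ (m - 1) - 3"
    and "int (boomerang_nu F 2) = 2 ^ (2 * m - 1) - 2 ^ (m - 1) - 1"
    and "boomerang_nu F 4 = 3"
    and "i \<notin> {0, 2, 4} \<Longrightarrow> boomerang_nu F i = 0"
proof -
  obtain w :: 'a where w: "w ^ 2 = w + 1" "w \<notin> L"
    using cube_root_exists[OF assms] .
  \<comment> \<open>The other primitive cube root \<open>w + 1\<close> meets the same hypotheses, so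
    each fact about \<open>w\<close> also yields one for the value \<open>e + 1\<close>.\<close>
  have "(w + 1) ^ 2 = w ^ 2 + 1" by (simp add: power2_eq_square algebra_simps)
  then have w': "(w + 1) ^ 2 = (w + 1) + 1" "w + 1 \<notin> L"
    using w by simp_all
  define e where "e = F w"
  have e1: "F (w + 1) = e + 1" using F_w_1[OF w] by (simp add: e_def)
  have e: "e \<notin> B \<union> {0, 1}" "e + 1 \<notin> B \<union> {0, 1}"
    using F_w_notin[OF w] F_w_notin[OF w'] unfolding e1 e_def by blast+
  have B: "1 \<in> B" using one_in_B[OF w] .
  let ?E = "{1, e, e + 1}"
  have count4: "boomerang_count F 1 e = 4" "boomerang_count F 1 (e + 1) = 4"
    using boomerang_count_F_w[OF w] boomerang_count_F_w[OF w'] unfolding e1 by (simp_all add: e_def)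
  have count': "boomerang_count F 1 b = (if b \<in> B then 2 else 0) + (if b = 1 then 2 else 0)"
    if "b \<noteq> 0" "b \<noteq> e" "b \<noteq> e + 1" for b
    by (rule boomerang_count_no_root) (use that sols_0_iff[OF w] in \<open>auto simp: e_def\<close>)
  \<comment> \<open>The three values with count 4 have two origins: at 1, two solutions from
    \<open>B\<close> join (0, 1) and (1, 0); at \<open>e\<close> and \<open>e + 1\<close>, all four
    are exceptional.\<close>
  have count: "boomerang_count F 1 b = (if b \<in> ?E then 4 else if b \<in> B then 2 else 0)"
    if "b \<noteq> 0" for b
    using count4 count'[of b] that B e by auto
  have nu: "boomerang_nu F i = card {b. b \<noteq> 0 \<and> (if b \<in> ?E then 4 else if b \<in> B then 2 else 0) = i}" for i
    unfolding boomerang_nu_def by (metis (no_types, lifting) count)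
  have "card B > 0" using B by (auto simp: card_gt_0_iff)
  have "{b. b \<noteq> 0 \<and> (if b \<in> ?E then 4 else if b \<in> B then 2 else 0) = (0::nat)}
      = UNIV - insert 0 (insert e (insert (e + 1) B))"
    using B by auto
  then show "int (boomerang_nu F 0) = 2 ^ (2 * m - 1) + 2 ^ (m - 1) - 3"
    unfolding nu using card_nonzero_Diff[of "insert e (insert (e + 1) B)"] e zero_notin_B card_B_int
    by simp
  have "{b. b \<noteq> 0 \<and> (if b \<in> ?E then 4 else if b \<in> B then 2 else 0) = (2::nat)} = B - {1}"
    using e zero_notin_B by auto
  then show "int (boomerang_nu F 2) = 2 ^ (2 * m - 1) - 2 ^ (m - 1) - 1"
    unfolding nu using card_B_int B \<open>card B > 0\<close> by (simp add: of_nat_diff)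
  have "{b. b \<noteq> 0 \<and> (if b \<in> ?E then 4 else if b \<in> B then 2 else 0) = (4::nat)} = ?E"
    using e by auto
  then show "boomerang_nu F 4 = 3"
    unfolding nu using e by auto
  show "i \<notin> {0, 2, 4} \<Longrightarrow> boomerang_nu F i = 0"
    unfolding nu by (auto simp: card_eq_0_iff)
qed

end

theorem theorem2:
  fixes m k q :: nat
    and F :: "'a::finite_field \<Rightarrow> 'a"
  assumes "m > 0" and "k > 0"
    and "q = 2 ^ m"
    and "gcd k (q + 1) = 1"
    and "card (UNIV :: 'a set) = q ^ 2"
    and "F = (\<lambda>x. x ^ (k * (q - 1)))"
  shows "(even m \<longrightarrow>
            int (boomerang_nu F 0) = 2 ^ (2 * m - 1) + 2 ^ (m - 1) - 2 \<and>
            int (boomerang_nu F 2) = 2 ^ (2 * m - 1) - 2 ^ (m - 1) + 1 \<and>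
            (\<forall>i. i \<notin> {0, 2} \<longrightarrow> boomerang_nu F i = 0)) \<and>
         (odd m \<longrightarrow>
            int (boomerang_nu F 0) = 2 ^ (2 * m - 1) + 2 ^ (m - 1) - 3 \<and>
            int (boomerang_nu F 2) = 2 ^ (2 * m - 1) - 2 ^ (m - 1) - 1 \<and>
            boomerang_nu F 4 = 3 \<and>
            (\<forall>i. i \<notin> {0, 2, 4} \<longrightarrow> boomerang_nu F i = 0))"
proof -
  interpret niho_power m k q F
    using assms by unfold_locales (auto simp: coprime_iff_gcd_eq_1)
  show ?thesis
    using spectrum_even spectrum_odd by blast
qed

end
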